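(* There exists an absolute constant $C_0>0$, and for all constants $c,c'>0$ there exist constants $C_1,C_2>0$ depending only on $c,c'$, such that the following holds. Let $d_1,d_2$ be positive integers, $\alpha\ge1$ and $r\ge4$ be such that $\alpha^2r\max\{d_1,d_2\}\ge C_0$. Let $f:\mathbb{R}\to[0,1]$ be a differentiable function for which $$L_1:=\sup_{|x|\le1}\frac{|f'(x)|}{f(x)(1-f(x))}$$ is well-defined (finite), and suppose that $f'(x)\ge c$ and $c'\le f(x)\le1-c'$ for $x\in[-1,1]$. Let $$K=\left\{M\in\mathbb{R}^{d_1\times d_2}:\ \|M\|_*\le\alpha\sqrt{rd_1d_2},\ \|M\|_\infty\le\alpha\right\}.$$ Let $\Omega$ be any subset of $[d_1]\times[d_2]$ with cardinality $n$, and for $M\in K$ let $Y_{i,j}$, $(i,j)\in\Omega$, be generated from $M$ via $f$ according to the 1-bit observation model described in the context. Consider any algorithm which, for any $M\in K$, takes as input $Y_{i,j}$ for $(i,j)\in\Omega$ and returns $\widehat{M}$. Then there exists $M\in K$ such that with probability at least $3/4$, $$d_H^2(f(M),f(\widehat{M}))\ge\min\left\{C_1,\ C_2\,\frac{\alpha}{L_1}\sqrt{\frac{r\max\{d_1,d_2\}}{n}}\right\},$$ as long as the right-hand side of this inequality exceeds $r\alpha^2/\min(d_1,d_2)$.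
   Context: Notation: $[d]=\{1,\dots,d\}$; $\|\cdot\|_*$ is the nuclear norm (sum of singular values), $\|X\|_\infty=\max_{i,j}|X_{i,j}|$; $f(M)$ denotes $f$ applied entrywise. 1-bit observation model: for $(i,j)\in\Omega$ one observes, independently, $Y_{i,j}=+1$ with probability $f(M_{i,j})$ and $Y_{i,j}=-1$ with probability $1-f(M_{i,j})$. Hellinger distance: for $p,q\in[0,1]$, $d_H^2(p,q)=(\sqrt p-\sqrt q)^2+(\sqrt{1-p}-\sqrt{1-q})^2$; for $P,Q\in[0,1]^{d_1\times d_2}$, $d_H^2(P,Q)=\frac{1}{d_1d_2}\sum_{i,j}d_H^2(P_{i,j},Q_{i,j})$. *)

theory Defs
  imports
    "HOL-Probability.Probability"
    "HOL-Computational_Algebra.Computational_Algebra"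
    "Jordan_Normal_Form.Char_Poly"
begin

(* The singular values of A are the square roots of the eigenvalues of the matrix A^T A, counted
   with algebraic multiplicity. A^T A is real symmetric and positive semidefinite, so all roots of
   its characteristic polynomial are real and nonnegative and the multiset below has dim_col A
   elements; the zero singular values that it contains do not affect the sum. *)
definition singular_values :: "real mat \<Rightarrow> real multiset" where
  "singular_values A = image_mset sqrt (proots (char_poly (transpose_mat A * A)))"

definition nuclear_norm :: "real mat \<Rightarrow> real" where
  "nuclear_norm A = sum_mset (singular_values A)"

definition max_norm :: "real mat \<Rightarrow> real" where
  "max_norm A = Max (abs ` elements_mat A)"

definition matrix_class :: "nat \<Rightarrow> nat \<Rightarrow> real \<Rightarrow> real \<Rightarrow> real mat set" where
  "matrix_class d1 d2 \<alpha> r =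
     {M \<in> carrier_mat d1 d2.
        nuclear_norm M \<le> \<alpha> * sqrt (r * real d1 * real d2) \<and> max_norm M \<le> \<alpha>}"

definition hellinger_sq :: "real \<Rightarrow> real \<Rightarrow> real" where
  "hellinger_sq p q = (sqrt p - sqrt q)^2 + (sqrt (1 - p) - sqrt (1 - q))^2"

(* P and Q are assumed to have the same dimensions. *)
definition hellinger_sq_mat :: "real mat \<Rightarrow> real mat \<Rightarrow> real" where
  "hellinger_sq_mat P Q =
     1 / (real (dim_row P) * real (dim_col P)) *
     (\<Sum>i<dim_row P. \<Sum>j<dim_col P. hellinger_sq (P $$ (i,j)) (Q $$ (i,j)))"

definition L1_const :: "(real \<Rightarrow> real) \<Rightarrow> real" where
  "L1_const f = (SUP x\<in>{-1..1}. \<bar>deriv f x\<bar> / (f x * (1 - f x)))"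

(* The joint law of the independent signs Y (i,j), (i,j) in Omega. An outcome is a function on all
   index pairs that is constantly 0 outside Omega, so it carries no information beyond the
   observed entries. *)
definition one_bit_obs ::
  "(real \<Rightarrow> real) \<Rightarrow> real mat \<Rightarrow> (nat \<times> nat) set \<Rightarrow> (nat \<times> nat \<Rightarrow> int) pmf" where
  "one_bit_obs f M \<Omega> =
     Pi_pmf \<Omega> 0 (\<lambda>ij. map_pmf (\<lambda>b. if b then 1 else -1) (bernoulli_pmf (f (M $$ ij))))"

(* The space of d1 x d2 matrices with the sigma-algebra generated by the entries, that is, the
   Borel sigma-algebra. *)
definition mat_borel :: "nat \<Rightarrow> nat \<Rightarrow> real mat measure" where
  "mat_borel d1 d2 =
     vimage_algebra (carrier_mat d1 d2)
       (\<lambda>A. \<lambda>ij\<in>{..<d1} \<times> {..<d2}. A $$ ij) (PiM ({..<d1} \<times> {..<d2}) (\<lambda>_. borel))"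

(* An algorithm maps the observation to the law of its output, so that it may use internal
   randomness independent of the observation. Deterministic algorithms are the special case in
   which all of these laws are point masses; see the lemma below. *)
definition mat_algorithm ::
  "nat \<Rightarrow> nat \<Rightarrow> ((nat \<times> nat \<Rightarrow> int) \<Rightarrow> real mat measure) \<Rightarrow> bool" where
  "mat_algorithm d1 d2 A \<longleftrightarrow> A \<in> count_space UNIV \<rightarrow>\<^sub>M prob_algebra (mat_borel d1 d2)"

definition estimate_law ::
  "(real \<Rightarrow> real) \<Rightarrow> real mat \<Rightarrow> (nat \<times> nat) set \<Rightarrow>
     ((nat \<times> nat \<Rightarrow> int) \<Rightarrow> real mat measure) \<Rightarrow> real mat measure" where
  "estimate_law f M \<Omega> A = Giry_Monad.bind (measure_pmf (one_bit_obs f M \<Omega>)) A"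

lemma space_mat_borel [simp]: "space (mat_borel d1 d2) = carrier_mat d1 d2"
  by (simp add: mat_borel_def)

lemma measurable_mat_entry:
  assumes "i < d1" "j < d2"
  shows "(\<lambda>A. A $$ (i,j)) \<in> borel_measurable (mat_borel d1 d2)"
proof -
  let ?I = "{..<d1} \<times> {..<d2}"
  let ?\<phi> = "\<lambda>A. \<lambda>ij\<in>?I. (A :: real mat) $$ ij"
  have \<phi>: "?\<phi> \<in> mat_borel d1 d2 \<rightarrow>\<^sub>M PiM ?I (\<lambda>_. borel)"
    unfolding mat_borel_def by (rule measurable_vimage_algebra1) (auto simp: space_PiM)
  have "(\<lambda>w. w (i,j)) \<in> PiM ?I (\<lambda>_. borel) \<rightarrow>\<^sub>M (borel :: real measure)"
    using assms by (intro measurable_component_singleton) auto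
  from measurable_compose[OF \<phi> this] show ?thesis using assms by simp
qed

lemma mat_algorithm_deterministic:
  assumes "\<And>y. g y \<in> carrier_mat d1 d2"
  shows "mat_algorithm d1 d2 (\<lambda>y. return (mat_borel d1 d2) (g y))"
  using assms by (auto simp: mat_algorithm_def space_prob_algebra intro!: prob_space_return)

lemma measurable_hellinger_sq_mat:
  assumes f: "\<And>x. f differentiable (at x)" and M: "M \<in> carrier_mat d1 d2"
  shows "{B \<in> carrier_mat d1 d2. t \<le> hellinger_sq_mat (map_mat f M) (map_mat f B)}
    \<in> sets (mat_borel d1 d2)"
proof -
  have "continuous_on UNIV f"
    using f by (intro differentiable_imp_continuous_on) (auto simp: differentiable_on_def)
  then have fm: "f \<in> borel_measurable borel"
    by (rule borel_measurable_continuous_onI)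
  have fe: "(\<lambda>B. f (B $$ (i,j))) \<in> borel_measurable (mat_borel d1 d2)" if "i < d1" "j < d2" for i j
    using measurable_compose[OF measurable_mat_entry[OF that] fm] .
  have h: "(\<lambda>q. hellinger_sq p q) \<in> borel_measurable borel" for p
    unfolding hellinger_sq_def by measurable
  let ?g = "\<lambda>B. 1 / (real d1 * real d2) *
    (\<Sum>i<d1. \<Sum>j<d2. hellinger_sq (f (M $$ (i,j))) (f (B $$ (i,j))))"
  have "?g \<in> borel_measurable (mat_borel d1 d2)"
    by (intro borel_measurable_times borel_measurable_const borel_measurable_sum
        measurable_compose[OF fe h]) auto
  then have "{B \<in> space (mat_borel d1 d2). t \<le> ?g B} \<in> sets (mat_borel d1 d2)"
    by measurable
  also have "{B \<in> space (mat_borel d1 d2). t \<le> ?g B} =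
     {B \<in> carrier_mat d1 d2. t \<le> hellinger_sq_mat (map_mat f M) (map_mat f B)}"
    using M by (auto simp: hellinger_sq_mat_def)
  finally show ?thesis .
qed

end

theory Submission
  imports Defs "Jordan_Normal_Form.Schur_Decomposition"
begin

text \<open>
  Put a uniform prior on sign matrices with entries \<open>\<plusminus> s\<close>, \<open>s\<^sup>2 \<asymp> \<epsilon>\<close>, whose rows (or columns, along the
  shorter side) repeat with period \<open>B \<asymp> r \<alpha>\<^sup>2 / s\<^sup>2\<close>. They have rank at most \<open>B\<close>, so their nuclear norm is at
  most \<open>sqrt B\<close> times their Frobenius norm and they lie in \<open>K\<close>; they are parametrised by
  \<open>N = B * max d1 d2\<close> free bits. If one estimate is \<open>\<epsilon>\<close>-close to two of them, then these differ in at most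
  \<open>N / 8\<close> bits, so under a law of the data that ignores the matrix the success probability is at most the
  volume \<open>exp (- N / 8)\<close> of a Hamming ball. Changing the measure from that law (the one of the zero
  matrix) to the true one costs, by Cauchy--Schwarz, a factor \<open>sqrt (1 + \<chi>\<^sup>2)\<close>, and \<open>1 + \<chi>\<^sup>2 \<le> exp (N / 16)\<close> by the
  choice of \<open>\<epsilon>\<close>. Hence the average success probability over the prior is at most \<open>exp (- N / 32)\<close>.
\<close>

subsection \<open>Spectra of Gram matrices and the nuclear norm\<close>

text \<open>Sylvester's determinant identity: multiply the block matrix \<open>M\<close> below by \<open>R\<close> from the right and by \<open>L\<close>
  from the left; both products are block triangular.\<close>

lemma char_poly_mult_commute:
  fixes X Y :: "'a :: idom mat"
  assumes X: "X \<in> carrier_mat n k" and Y: "Y \<in> carrier_mat k n"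
  shows "[:0, 1:] ^ k * char_poly (X * Y) = [:0, 1:] ^ n * char_poly (Y * X)"
proof -
  interpret ch: comm_ring_hom "\<lambda>a :: 'a. [:a:]"
    by unfold_locales auto
  let ?C = "map_mat (\<lambda>a :: 'a. [:a:])"
  let ?x = "[:0, 1:] :: 'a poly"
  have cX: "?C X \<in> carrier_mat n k" and cY: "?C Y \<in> carrier_mat k n"
    using X Y by auto
  have cp: "char_poly_matrix Z = ?x \<cdot>\<^sub>m 1\<^sub>m l - ?C Z" if "Z \<in> carrier_mat l l" for Z l
    using that by (intro eq_matI) (auto simp: char_poly_matrix_def)
  have XY: "char_poly_matrix (X * Y) = ?x \<cdot>\<^sub>m 1\<^sub>m n - ?C X * ?C Y"
    using cp[of "X * Y" n] X Y ch.mat_hom_mult[OF X Y] by simp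
  have YX: "char_poly_matrix (Y * X) = ?x \<cdot>\<^sub>m 1\<^sub>m k - ?C Y * ?C X"
    using cp[of "Y * X" k] X Y ch.mat_hom_mult[OF Y X] by simp
  define M where "M = four_block_mat (?x \<cdot>\<^sub>m 1\<^sub>m n) (?C X) (?C Y) (1\<^sub>m k)"
  define R where "R = four_block_mat (1\<^sub>m n) (0\<^sub>m n k) (- ?C Y) (1\<^sub>m k)"
  define L where "L = four_block_mat (1\<^sub>m n) (0\<^sub>m n k) (- ?C Y) (?x \<cdot>\<^sub>m 1\<^sub>m k)"
  have cM: "M \<in> carrier_mat (n + k) (n + k)" and cR: "R \<in> carrier_mat (n + k) (n + k)"
    and cL: "L \<in> carrier_mat (n + k) (n + k)"
    unfolding M_def R_def L_def by (auto intro!: four_block_carrier_mat)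
  have "det M * det R = det (M * R)"
    using det_mult[OF cM cR] ..
  also have "M * R = four_block_mat (?x \<cdot>\<^sub>m 1\<^sub>m n - ?C X * ?C Y) (?C X) (0\<^sub>m k n) (1\<^sub>m k)"
    unfolding M_def R_def
    by (subst mult_four_block_mat[where ?nr1.0=n and ?n1.0=n and ?n2.0=k and ?nr2.0=k and ?nc1.0=n and ?nc2.0=k])
      (use cX cY in \<open>auto intro!: arg_cong4[where f=four_block_mat] simp: minus_add_uminus_mat[of _ n n]
         uminus_mult_right_mat\<close>)
  also have "det \<dots> = char_poly (X * Y)"
    by (subst det_four_block_mat_lower_left_zero[where n=n and m=k])
      (use cX cY in \<open>auto simp: char_poly_def XY\<close>)
  also have "det R = 1"
    unfolding R_def by (subst det_four_block_mat_upper_right_zero[where n=n and m=k]) (use cY in auto)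
  finally have 1: "det M = char_poly (X * Y)" by simp
  have "det L * det M = det (L * M)"
    using det_mult[OF cL cM] ..
  also have "L * M = four_block_mat (?x \<cdot>\<^sub>m 1\<^sub>m n) (?C X) (0\<^sub>m k n) (?x \<cdot>\<^sub>m 1\<^sub>m k - ?C Y * ?C X)"
    unfolding M_def L_def
    by (subst mult_four_block_mat[where ?nr1.0=n and ?n1.0=n and ?n2.0=k and ?nr2.0=k and ?nc1.0=n and ?nc2.0=k])
      (use cX cY in \<open>auto intro!: arg_cong4[where f=four_block_mat] simp: comm_add_mat[of _ k k] minus_add_uminus_mat[of _ k k]
         uminus_mult_left_mat mult_smult_distrib[of _ k n] mult_smult_assoc_mat[of _ k k] \<close>)
  also have "det \<dots> = ?x ^ n * char_poly (Y * X)"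
    by (subst det_four_block_mat_lower_left_zero[where n=n and m=k])
      (use cX cY in \<open>auto simp: char_poly_def YX\<close>)
  also have "det L = ?x ^ k"
    unfolding L_def by (subst det_four_block_mat_upper_right_zero[where n=n and m=k]) (use cY in auto)
  finally show ?thesis using 1 by simp
qed

text \<open>For an eigenvector \<open>v\<close>, \<open>a * |v|^2 = |A v|^2\<close>: the entries of
  \<open>A\<close> are real, so the transpose of its complexification is the adjoint.\<close>

lemma gram_eigenvalue_real_nonneg:
  fixes A :: "real mat"
  assumes A: "A \<in> carrier_mat m n"
    and ev: "eigenvalue (map_mat complex_of_real (A\<^sup>T * A)) a"
  shows "a = complex_of_real (Re a) \<and> 0 \<le> Re a"
proof -
  let ?A = "map_mat complex_of_real A"
  have cA: "?A \<in> carrier_mat m n" using A by simp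
  have AA: "map_mat complex_of_real (A\<^sup>T * A) = ?A\<^sup>T * ?A"
    using of_real_hom.mat_hom_mult[of "A\<^sup>T" n m A n] A by (simp add: map_mat_transpose)
  obtain v where v: "v \<in> carrier_vec n" "v \<noteq> 0\<^sub>v n" and eq: "(?A\<^sup>T * ?A) *\<^sub>v v = a \<cdot>\<^sub>v v"
    using ev A unfolding eigenvalue_def eigenvector_def AA by auto
  define w where "w = ?A *\<^sub>v v"
  have cw: "w \<in> carrier_vec m" using cA v by (auto simp: w_def)
  have conj: "conjugate w = ?A *\<^sub>v conjugate v"
    unfolding w_def using cA v
    by (intro eq_vecI) (auto simp: scalar_prod_def conjugate_complex_def sum_conjugate)
  have "a * (v \<bullet>c v) = (a \<cdot>\<^sub>v v) \<bullet>c v"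
    using v by simp
  also have "\<dots> = (?A\<^sup>T *\<^sub>v w) \<bullet> conjugate v"
    unfolding eq[symmetric] w_def using cA v by (subst assoc_mult_mat_vec[of _ n m _ n]) auto
  also have "\<dots> = w \<bullet> (?A *\<^sub>v conjugate v)"
    using transpose_vec_mult_scalar[OF cA, of "conjugate v" w] v cw by auto
  also have "\<dots> = w \<bullet>c w"
    unfolding conj ..
  finally have *: "a * (v \<bullet>c v) = w \<bullet>c w" .
  have "v \<bullet>c v > 0" using v by simp
  moreover have "w \<bullet>c w \<ge> 0" by (rule conjugate_square_ge_0_vec)
  ultimately have "a = complex_of_real (Re (w \<bullet>c w) / Re (v \<bullet>c v))" "Re (v \<bullet>c v) > 0" "Re (w \<bullet>c w) \<ge> 0"
    using * by (auto simp: less_complex_def less_eq_complex_def complex_eq_iff field_simps)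
  then show ?thesis by (metis Re_complex_of_real divide_nonneg_pos)
qed

lemma proots_linear_factors:
  "proots (\<Prod>a\<leftarrow>as. [:- a :: 'a :: idom, 1:]) = mset as"
proof (induction as)
  case (Cons a as)
  have "(\<Prod>a\<leftarrow>as. [:- a, 1:]) \<noteq> 0"
    by (auto simp: prod_list_zero_iff)
  then have "proots ([:- a, 1:] * (\<Prod>a\<leftarrow>as. [:- a, 1:])) = {#a#} + proots (\<Prod>a\<leftarrow>as. [:- a, 1:])"
    by (subst proots_mult) auto
  then show ?case using Cons by simp
qed simp

lemma trace_mult_commute:
  fixes X Y :: "'a :: comm_semiring_0 mat"
  assumes X: "X \<in> carrier_mat n k" and Y: "Y \<in> carrier_mat k n"
  shows "(\<Sum>i<n. (X * Y) $$ (i,i)) = (\<Sum>i<k. (Y * X) $$ (i,i))"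
proof -
  have "(\<Sum>i<n. (X * Y) $$ (i,i)) = (\<Sum>i<n. \<Sum>j<k. X $$ (i,j) * Y $$ (j,i))"
    using X Y by (intro sum.cong) (auto simp: scalar_prod_def lessThan_atLeast0)
  also have "\<dots> = (\<Sum>j<k. \<Sum>i<n. Y $$ (j,i) * X $$ (i,j))"
    by (subst sum.swap) (simp add: mult.commute)
  also have "\<dots> = (\<Sum>i<k. (Y * X) $$ (i,i))"
    using X Y by (intro sum.cong) (auto simp: scalar_prod_def lessThan_atLeast0)
  finally show ?thesis .
qed

text \<open>A Schur form of \<open>A\<close> is upper triangular with the same characteristic
  polynomial, so its diagonal is \<open>as\<close> up to order; similarity preserves the
  trace.\<close>

lemma sum_eigenvalues_eq_trace:
  fixes A :: "real mat"
  assumes A: "A \<in> carrier_mat n n" and cp: "char_poly A = (\<Prod>a\<leftarrow>as. [:- a, 1:])"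
  shows "sum_list as = (\<Sum>i<n. A $$ (i,i))"
proof -
  define B where "B = schur_upper_triangular A as"
  have B: "B \<in> carrier_mat n n" "upper_triangular B" "similar_mat A B"
    unfolding B_def using schur_upper_triangular[OF A cp] by auto
  obtain P Q where PQ: "similar_mat_wit A B P Q"
    using B(3) by (auto simp: similar_mat_def)
  note w = similar_mat_witD2[OF A PQ]
  have "(\<Prod>a\<leftarrow>as. [:- a, 1:]) = (\<Prod>a\<leftarrow>diag_mat B. [:- a, 1:])"
    using char_poly_similar[OF B(3)] char_poly_upper_triangular[OF B(1,2)] cp by simp
  then have "mset as = mset (diag_mat B)"
    using proots_linear_factors by metis
  then have "sum_list as = sum_list (diag_mat B)"
    by (metis sum_mset_sum_list)
  also have "\<dots> = (\<Sum>i<n. B $$ (i,i))"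
    using B(1) by (simp add: diag_mat_def sum_list_sum_nth lessThan_atLeast0)
  \<comment> \<open>Inserting \<open>Q * P = 1\<close> lets \<open>P\<close> be cycled to the front,
    where \<open>P * B * Q\<close> is \<open>A\<close>.\<close>
  also have "B = B * (Q * P)"
    using w B(1) by simp
  also have "\<dots> = B * Q * P"
    using w by (simp add: assoc_mult_mat[of _ n n _ n _ n])
  also have "(\<Sum>i<n. (B * Q * P) $$ (i,i)) = (\<Sum>i<n. (P * (B * Q)) $$ (i,i))"
    using w by (intro trace_mult_commute) auto
  also have "P * (B * Q) = A"
    using w by (simp add: assoc_mult_mat[of _ n n _ n _ n])
  finally show ?thesis .
qed

text \<open>The polynomial splits over the complex numbers with real nonnegative roots; the
  factorization descends because the embedding of real polynomials is injective.\<close>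

lemma char_poly_gram_factorized:
  fixes A :: "real mat"
  assumes A: "A \<in> carrier_mat m n"
  obtains as where "char_poly (A\<^sup>T * A) = (\<Prod>a\<leftarrow>as. [:- a, 1:])" "\<And>a. a \<in> set as \<Longrightarrow> 0 \<le> a"
proof -
  let ?G = "A\<^sup>T * A"
  have G: "?G \<in> carrier_mat n n" using A by simp
  have cG: "map_mat complex_of_real ?G \<in> carrier_mat n n" using G by simp
  obtain as where as: "char_poly (map_mat complex_of_real ?G) = (\<Prod>a\<leftarrow>as. [:- a, 1:])"
    using char_poly_factorized[OF cG] by blast
  have real: "a = complex_of_real (Re a) \<and> 0 \<le> Re a" if "a \<in> set as" for a
  proof (rule gram_eigenvalue_real_nonneg[OF A])
    have "poly (char_poly (map_mat complex_of_real ?G)) a = 0"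
      unfolding as using that by (auto simp: poly_prod_list prod_list_zero_iff)
    then show "eigenvalue (map_mat complex_of_real ?G) a"
      using eigenvalue_root_char_poly[OF cG] by simp
  qed
  interpret h: map_poly_inj_comm_ring_hom complex_of_real ..
  have "map_poly complex_of_real (char_poly ?G) = (\<Prod>a\<leftarrow>as. [:- a, 1:])"
    using of_real_hom.char_poly_hom[OF G, where ?'a=complex] as by simp
  also have "\<dots> = (\<Prod>a\<leftarrow>as. map_poly complex_of_real [:- Re a, 1:])"
    using real by (intro arg_cong[of _ _ prod_list] map_cong) (auto simp: complex_eq_iff)
  also have "\<dots> = map_poly complex_of_real (\<Prod>a\<leftarrow>map Re as. [:- a, 1:])"
    by (simp add: h.hom_prod_list o_def)
  finally have "char_poly ?G = (\<Prod>a\<leftarrow>map Re as. [:- a, 1:])"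
    by simp
  then show thesis
    using that[of "map Re as"] real by auto
qed

text \<open>Cauchy-Schwarz against the all-ones vector.\<close>

lemma sum_mset_sqrt_le:
  assumes "\<And>x. x \<in># M \<Longrightarrow> 0 \<le> x"
  shows "sum_mset (image_mset sqrt M) \<le> sqrt (real (size M) * sum_mset M)"
proof -
  obtain xs where M: "M = mset xs" using ex_mset by metis
  have "(\<Sum>i<length xs. sqrt (xs ! i))\<^sup>2 \<le> (\<Sum>i<length xs. (sqrt (xs ! i))\<^sup>2) * card {..<length xs}"
    by (rule sum_squared_le_sum_of_squares) 
  also have "(\<Sum>i<length xs. (sqrt (xs ! i))\<^sup>2) = (\<Sum>i<length xs. xs ! i)"
    using assms by (intro sum.cong) (auto simp: M)
  finally have "(sum_list (map sqrt xs))\<^sup>2 \<le> sum_list xs * length xs"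
    by (simp add: sum_list_sum_nth lessThan_atLeast0)
  then have "(sum_mset (image_mset sqrt M))\<^sup>2 \<le> real (size M) * sum_mset M"
    by (simp add: M sum_mset_sum_list mult.commute flip: mset_map)
  then show ?thesis by (rule real_le_rsqrt)
qed

text \<open>Sylvester's identity trades the Gram matrix of \<open>U * V\<close> for a
  \<open>k\<close> by \<open>k\<close> matrix with the same roots apart from \<open>n - k\<close>
  zeros. So at most \<open>k\<close> singular values matter, and Cauchy-Schwarz compares their sum
  with the trace, the squared Frobenius norm.\<close>

lemma nuclear_norm_mult_le:
  assumes U: "U \<in> carrier_mat m k" and V: "V \<in> carrier_mat k n" and kn: "k \<le> n"
  shows "nuclear_norm (U * V) \<le> sqrt (real k * (\<Sum>i<m. \<Sum>j<n. ((U * V) $$ (i,j))\<^sup>2))"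
proof -
  define M where "M = U * V"
  let ?G = "M\<^sup>T * M"
  have M: "M \<in> carrier_mat m n" using U V by (simp add: M_def)
  define q where "q = char_poly (U\<^sup>T * M * V\<^sup>T)"
  have UMV: "U\<^sup>T * M * V\<^sup>T \<in> carrier_mat k k" using U V M by simp
  have q: "degree q = k" "q \<noteq> 0"
    using degree_monic_char_poly[OF UMV] by (auto simp: q_def)
  obtain as where as: "char_poly ?G = (\<Prod>a\<leftarrow>as. [:- a, 1:])" "\<And>a. a \<in> set as \<Longrightarrow> 0 \<le> a"
    using char_poly_gram_factorized[OF M] by blast
  have G: "?G = V\<^sup>T * (U\<^sup>T * M)"
    using U V M by (simp add: M_def transpose_mult[OF U V] assoc_mult_mat[of _ n k _ m _ n])
  have "[:0, 1:] ^ k * char_poly ?G = [:0, 1:] ^ n * q"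
    unfolding G q_def using U V M by (intro char_poly_mult_commute) auto
  also have "\<dots> = [:0, 1:] ^ k * ([:0, 1:] ^ (n - k) * q)"
    using kn by (simp add: mult.assoc flip: power_add)
  finally have "char_poly ?G = [:0, 1:] ^ (n - k) * q"
    by simp
  then have roots: "mset as = repeat_mset (n - k) {#0#} + proots q"
    using q proots_linear_factors[of as] by (simp add: as proots_mult proots_power)
  have nonneg: "0 \<le> x" if "x \<in># proots q" for x
    using as(2)[of x] that roots by (metis set_mset_mset union_iff)
  have rep: "sum_mset (repeat_mset l {#0 :: real#}) = 0" for l
    by (induction l) auto
  have "nuclear_norm M = sum_mset (image_mset sqrt (mset as))"
    by (simp add: nuclear_norm_def singular_values_def as proots_linear_factors)
  also have "\<dots> = sum_mset (image_mset sqrt (proots q))"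
    by (simp add: roots rep)
  also have "\<dots> \<le> sqrt (real (size (proots q)) * sum_mset (proots q))"
    by (rule sum_mset_sqrt_le) (rule nonneg)
  also have "sum_mset (proots q) = sum_list as"
    using arg_cong[OF roots, of sum_mset] by (simp add: rep sum_mset_sum_list)
  also have "sqrt (real (size (proots q)) * sum_list as) \<le> sqrt (real k * sum_list as)"
    using size_proots_le[of q] q as(2)
    by (intro real_sqrt_le_mono mult_right_mono sum_list_nonneg) auto
  also have "sum_list as = (\<Sum>j<n. ?G $$ (j,j))"
    using M as by (intro sum_eigenvalues_eq_trace) auto
  also have "(\<Sum>j<n. ?G $$ (j,j)) = (\<Sum>j<n. \<Sum>i<m. (M $$ (i,j))\<^sup>2)"
    using M by (intro sum.cong) (auto simp: scalar_prod_def lessThan_atLeast0 power2_eq_square)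
  also have "(\<Sum>j<n. \<Sum>i<m. (M $$ (i,j))\<^sup>2) = (\<Sum>i<m. \<Sum>j<n. (M $$ (i,j))\<^sup>2)"
    by (rule sum.swap)
  finally show ?thesis unfolding M_def .
qed

subsection \<open>Hellinger distance\<close>

text \<open>The factor 2 is the price of working with squared distances.\<close>

lemma hellinger_sq_quasi_triangle:
  "hellinger_sq p q \<le> 2 * hellinger_sq p r + 2 * hellinger_sq q r"
proof -
  have *: "(a - b)\<^sup>2 \<le> 2 * (a - c)\<^sup>2 + 2 * (b - c)\<^sup>2" for a b c :: real
    using zero_le_power2[of "a + b - 2 * c"] by (simp add: power2_eq_square algebra_simps)
  show ?thesis
    using add_mono[OF *[of "sqrt p" "sqrt q" "sqrt r"] *[of "sqrt (1 - p)" "sqrt (1 - q)" "sqrt (1 - r)"]]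
    by (simp add: hellinger_sq_def algebra_simps)
qed

text \<open>Each of the two squares is at least \<open>(p - q)^2 / 4\<close>, because a sum of two
  square roots of numbers in the unit interval is at most 2.\<close>

lemma hellinger_sq_ge:
  assumes "p \<in> {0..1}" "q \<in> {0..1}"
  shows "(p - q)\<^sup>2 / 2 \<le> hellinger_sq p q"
proof -
  have *: "(x - y)\<^sup>2 \<le> 4 * (sqrt x - sqrt y)\<^sup>2" if "x \<in> {0..1}" "y \<in> {0..1}" for x y :: real
  proof -
    have "(x - y)\<^sup>2 = (sqrt x - sqrt y)\<^sup>2 * (sqrt x + sqrt y)\<^sup>2"
      using that by (simp add: algebra_simps flip: power_mult_distrib)
    also have "\<dots> \<le> (sqrt x - sqrt y)\<^sup>2 * 2\<^sup>2"
      using that by (intro mult_left_mono power_mono) (auto intro: add_mono[of "sqrt x" 1 "sqrt y" 1, simplified])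
    finally show ?thesis by simp
  qed
  have "(p - q)\<^sup>2 \<le> 4 * (sqrt (1 - p) - sqrt (1 - q))\<^sup>2"
    using *[of "1 - p" "1 - q"] assms by (simp add: power2_commute)
  then show ?thesis
    using *[OF assms] unfolding hellinger_sq_def by linarith
qed

lemma hellinger_sq_nonneg: "0 \<le> hellinger_sq p q"
  by (simp add: hellinger_sq_def)

lemma hellinger_sq_mat_quasi_triangle:
  assumes "P \<in> carrier_mat d1 d2" "Q \<in> carrier_mat d1 d2" "R \<in> carrier_mat d1 d2"
  shows "hellinger_sq_mat P Q \<le> 2 * hellinger_sq_mat P R + 2 * hellinger_sq_mat Q R"
proof -
  let ?S = "\<lambda>P Q. \<Sum>i<d1. \<Sum>j<d2. hellinger_sq (P $$ (i,j)) (Q $$ (i,j))"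
  have "?S P Q \<le> (\<Sum>i<d1. \<Sum>j<d2. 2 * hellinger_sq (P $$ (i,j)) (R $$ (i,j)) + 2 * hellinger_sq (Q $$ (i,j)) (R $$ (i,j)))"
    by (intro sum_mono hellinger_sq_quasi_triangle)
  also have "\<dots> = 2 * ?S P R + 2 * ?S Q R"
    by (simp add: sum.distrib sum_distrib_left)
  finally have "1 / (real d1 * real d2) * ?S P Q \<le> 1 / (real d1 * real d2) * (2 * ?S P R + 2 * ?S Q R)"
    by (intro mult_left_mono) auto
  also have "\<dots> = 2 * (1 / (real d1 * real d2) * ?S P R) + 2 * (1 / (real d1 * real d2) * ?S Q R)"
    by (rule distrib_left[THEN trans]) (simp only: mult.left_commute)
  finally show ?thesis
    using assms by (simp add: hellinger_sq_mat_def)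
qed

subsection \<open>Hamming balls\<close>

text \<open>Symmetric difference with \<open>T\<close> is an involution of \<open>Pow I\<close>,
  which reduces the sum to the binomial expansion.\<close>

lemma sum_power_card_sym_diff:
  fixes x :: "'b :: comm_semiring_1"
  assumes "finite I" "T \<subseteq> I"
  shows "(\<Sum>S\<in>Pow I. x ^ card (sym_diff S T)) = (1 + x) ^ card I"
proof -
  have "(\<Sum>S\<in>Pow I. x ^ card (sym_diff S T)) = (\<Sum>S\<in>Pow I. x ^ card S)"
    using assms(2) by (intro sum.reindex_bij_witness[where i="\<lambda>S. sym_diff S T" and j="\<lambda>S. sym_diff S T"]) auto
  also have "\<dots> = (\<Sum>S\<in>Pow I. (\<Prod>i\<in>S. x) * (\<Prod>i\<in>I - S. 1))"
    by simp
  also have "\<dots> = (\<Prod>i\<in>I. x + 1)"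
    using assms(1) by (rule prod_add[symmetric])
  finally show ?thesis by (simp add: add.commute)
qed

text \<open>Chernoff's method: on the ball the weight
  \<open>exp (N / 8 - card (sym_diff S T))\<close> is at least 1, and its sum over all of
  \<open>Pow I\<close> is explicit.\<close>

lemma card_hamming_ball_le:
  assumes "finite I" "T \<subseteq> I"
  shows "real (card {S \<in> Pow I. 8 * card (sym_diff S T) \<le> card I}) \<le> exp (- real (card I) / 8) * 2 ^ card I"
proof -
  define N where "N = card I"
  let ?B = "{S \<in> Pow I. 8 * card (sym_diff S T) \<le> card I}"
  have "real (card ?B) = (\<Sum>S\<in>?B. 1)" by simp
  also have "\<dots> \<le> (\<Sum>S\<in>?B. exp (real N / 8) * exp (- 1) ^ card (sym_diff S T))"
    by (intro sum_mono) (auto simp: N_def simp flip: exp_of_nat_mult exp_add)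
  also have "\<dots> \<le> (\<Sum>S\<in>Pow I. exp (real N / 8) * exp (- 1) ^ card (sym_diff S T))"
    using assms by (intro sum_mono2) auto
  also have "\<dots> = exp (real N / 8) * (1 + exp (- 1)) ^ N"
    using sum_power_card_sym_diff[OF assms, of "exp (- 1 :: real)"]
      by (simp add: N_def flip: sum_distrib_left)
  also have "\<dots> \<le> exp (real N / 8) * (2 * exp (- 1 / 4)) ^ N"
  proof (intro mult_left_mono power_mono)
    \<comment> \<open>Both sides are compared with \<open>3 / 2\<close>.\<close>
    have "exp (- 1 :: real) \<le> 1 / 2"
      using exp_ge_add_one_self[of "1 :: real"] by (simp add: exp_minus field_simps)
    moreover have "3 / 4 \<le> exp (- 1 / 4 :: real)"
      using exp_ge_add_one_self[of "- 1 / 4 :: real"] by simp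
    ultimately show "1 + exp (- 1 :: real) \<le> 2 * exp (- 1 / 4)" by linarith
  qed (auto intro: add_nonneg_nonneg)
  also have "\<dots> = exp (real N / 8 - real N / 4) * 2 ^ N"
  proof -
    have "exp (- 1 / 4 :: real) ^ N = exp (- (real N / 4))"
      by (simp flip: exp_of_nat_mult)
    then show ?thesis
      by (simp add: power_mult_distrib mult_exp_exp)
  qed
  finally show ?thesis by (simp add: N_def)
qed

subsection \<open>Testing against a reference law\<close>

text \<open>Since no output lies in more than a fraction \<open>v\<close> of the sets
  \<open>E \<sigma>\<close>, the average over \<open>\<sigma>\<close> of the success probability
  given any fixed data is at most \<open>v\<close>. Passing from the common law \<open>Q\<close> to
  \<open>P \<sigma>\<close> by Cauchy-Schwarz bounds the average success by
  \<open>sqrt (v * R)\<close>, and some \<open>\<sigma>\<close> does no better than the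
  average.\<close>

lemma exists_hypothesis_small_success:
  fixes P :: "'s \<Rightarrow> 'y pmf" and Q :: "'y pmf" and E :: "'s \<Rightarrow> 'm set"
  assumes S: "finite S" "S \<noteq> {}" and Y: "finite Y"
    and A: "A \<in> count_space UNIV \<rightarrow>\<^sub>M prob_algebra N"
    and E: "\<And>\<sigma>. \<sigma> \<in> S \<Longrightarrow> E \<sigma> \<in> sets N"
    and v: "0 < v" "\<And>x. x \<in> space N \<Longrightarrow> real (card {\<sigma> \<in> S. x \<in> E \<sigma>}) \<le> v * real (card S)"
    and supp: "\<And>\<sigma>. \<sigma> \<in> S \<Longrightarrow> set_pmf (P \<sigma>) \<subseteq> Y" "Y \<subseteq> set_pmf Q"
    and R: "0 < R" "\<And>\<sigma>. \<sigma> \<in> S \<Longrightarrow> (\<Sum>y\<in>Y. (pmf (P \<sigma>) y)\<^sup>2 / pmf Q y) \<le> R"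
  shows "\<exists>\<sigma>\<in>S. measure (Giry_Monad.bind (measure_pmf (P \<sigma>)) A) (E \<sigma>) \<le> sqrt (v * R)"
proof (rule ccontr)
  assume contra: "\<not> ?thesis"
  define p where "p \<sigma> = measure (Giry_Monad.bind (measure_pmf (P \<sigma>)) A) (E \<sigma>)" for \<sigma>
  define a where "a y \<sigma> = measure (A y) (E \<sigma>)" for y \<sigma>
  define t where "t = sqrt (v / R)"
  have t: "0 < t" using v(1) R(1) by (simp add: t_def)
  have "A y \<in> space (prob_algebra N)" for y
    using measurable_space[OF A, of y] by simp
  then have Ay: "prob_space (A y)" "sets (A y) = sets N" for y
    by (auto simp: space_prob_algebra)
  have a01: "0 \<le> a y \<sigma>" "a y \<sigma> \<le> 1" for y \<sigma>
    using prob_space.prob_le_1[OF Ay(1)] by (auto simp: a_def)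
  have sum_a: "(\<Sum>\<sigma>\<in>S. a y \<sigma>) \<le> v * real (card S)" for y
  proof -
    interpret prob_space "A y" by (rule Ay)
    have "(\<Sum>\<sigma>\<in>S. a y \<sigma>) = (\<Sum>\<sigma>\<in>S. \<integral>x. indicator (E \<sigma>) x \<partial>A y)"
      using E Ay(2) by (intro sum.cong) (auto simp: a_def)
    also have "\<dots> = (\<integral>x. (\<Sum>\<sigma>\<in>S. indicator (E \<sigma>) x) \<partial>A y)"
      using E Ay(2)[of y] by (intro Bochner_Integration.integral_sum[symmetric]) (auto simp: less_top[symmetric])
    also have "\<dots> \<le> (\<integral>x. v * real (card S) \<partial>A y)"
    proof (rule integral_mono)
      show "integrable (A y) (\<lambda>x. \<Sum>\<sigma>\<in>S. indicator (E \<sigma>) x :: real)"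
        using E Ay(2)[of y] by (intro Bochner_Integration.integrable_sum) (auto simp: less_top[symmetric])
      fix x assume "x \<in> space (A y)"
      then have "x \<in> space N" using sets_eq_imp_space_eq[OF Ay(2)] by blast
      from v(2)[OF this] show "(\<Sum>\<sigma>\<in>S. indicator (E \<sigma>) x) \<le> v * real (card S)"
        using S(1) by (simp add: indicator_def sum.If_cases Int_def)
    qed simp
    finally show ?thesis by (simp add: prob_space)
  qed
  have p: "p \<sigma> = (\<Sum>y\<in>Y. pmf (P \<sigma>) y * a y \<sigma>)" if "\<sigma> \<in> S" for \<sigma>
  proof -
    have "A \<in> measure_pmf (P \<sigma>) \<rightarrow>\<^sub>M subprob_algebra N"
      using measurable_prob_algebraD[OF A] by simp
    then have "p \<sigma> = (\<integral>y. a y \<sigma> \<partial>measure_pmf (P \<sigma>))"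
      unfolding p_def a_def
      using E[OF that] by (rule measure_pmf.measure_bind)
    also have "\<dots> = (\<Sum>y\<in>Y. a y \<sigma> * pmf (P \<sigma>) y)"
      using supp(1)[OF that] Y by (intro integral_measure_pmf_real) auto
    finally show ?thesis by (simp add: mult.commute)
  qed
  \<comment> \<open>The weight \<open>t\<close> makes the two sums that arise from AM-GM equal.\<close>
  have amgm: "pmf (P \<sigma>) y * a y \<sigma> \<le> (t * ((pmf (P \<sigma>) y)\<^sup>2 / pmf Q y) + pmf Q y * a y \<sigma> / t) / 2"
    if "y \<in> Y" for y \<sigma>
  proof -
    have Q: "0 < pmf Q y" using that supp(2) by (auto simp: pmf_positive)
    define u where "u = sqrt (t / pmf Q y) * pmf (P \<sigma>) y"
    define w where "w = sqrt (pmf Q y / t) * a y \<sigma>"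
    have "u * w = pmf (P \<sigma>) y * a y \<sigma>"
      using Q t by (simp add: u_def w_def real_sqrt_divide field_simps)
    moreover have "u\<^sup>2 = t * ((pmf (P \<sigma>) y)\<^sup>2 / pmf Q y)"
      using Q t by (simp add: u_def power_mult_distrib)
    moreover have "w\<^sup>2 \<le> pmf Q y * a y \<sigma> / t"
    proof -
      have "w\<^sup>2 = pmf Q y / t * (a y \<sigma>)\<^sup>2"
        using Q t by (simp add: w_def power_mult_distrib)
      \<comment> \<open>As \<open>a y \<sigma>\<close> is a probability, its square can be replaced
        by its first power, which is what \<open>sum_a\<close> controls.\<close>
      also have "\<dots> \<le> pmf Q y / t * a y \<sigma>"
        using a01[of y \<sigma>] Q t by (intro mult_left_mono) (auto simp: power2_eq_square mult_left_le)
      finally show ?thesis by simp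
    qed
    moreover have "u * w \<le> (u\<^sup>2 + w\<^sup>2) / 2"
      using sum_squares_bound[of u w] by simp
    ultimately show ?thesis
      by (smt (verit) divide_right_mono)
  qed
  have "(\<Sum>\<sigma>\<in>S. p \<sigma>) \<le> (\<Sum>\<sigma>\<in>S. \<Sum>y\<in>Y. (t * ((pmf (P \<sigma>) y)\<^sup>2 / pmf Q y) + pmf Q y * a y \<sigma> / t) / 2)"
    using amgm by (intro sum_mono) (simp add: p sum_mono)
  also have "\<dots> = (t * (\<Sum>\<sigma>\<in>S. \<Sum>y\<in>Y. (pmf (P \<sigma>) y)\<^sup>2 / pmf Q y) + (\<Sum>y\<in>Y. pmf Q y * (\<Sum>\<sigma>\<in>S. a y \<sigma>)) / t) / 2"
  proof -
    have "(\<Sum>y\<in>Y. pmf Q y * (\<Sum>\<sigma>\<in>S. a y \<sigma>)) = (\<Sum>\<sigma>\<in>S. \<Sum>y\<in>Y. pmf Q y * a y \<sigma>)"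
      by (subst sum.swap) (simp add: sum_distrib_left)
    then show ?thesis
      by (simp add: sum.distrib sum_distrib_left sum_divide_distrib add_divide_distrib)
  qed
  also have "\<dots> \<le> (t * (\<Sum>\<sigma>\<in>S. R) + (\<Sum>y\<in>Y. pmf Q y * (v * real (card S))) / t) / 2"
    using R(2) sum_a t by (intro divide_right_mono add_mono mult_left_mono sum_mono) auto
  also have "\<dots> = real (card S) * (t * R + (\<Sum>y\<in>Y. pmf Q y) * v / t) / 2"
    by (simp add: field_simps sum_distrib_left sum_distrib_right)
  also have "\<dots> \<le> real (card S) * (t * R + 1 * v / t) / 2"
    using Y v(1) t measure_pmf.prob_le_1[of Q Y]
    by (intro divide_right_mono add_mono mult_left_mono mult_right_mono) (auto simp: measure_measure_pmf_finite)
  also have "t * R + 1 * v / t = 2 * sqrt (v * R)"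
  proof -
    have "t * R = sqrt (v * R)" "v / t = sqrt (v * R)"
      using v(1) R(1) by (simp_all add: t_def real_sqrt_divide real_sqrt_mult real_div_sqrt field_simps)
    then show ?thesis by simp
  qed
  finally have "(\<Sum>\<sigma>\<in>S. p \<sigma>) \<le> real (card S) * sqrt (v * R)" by simp
  moreover have "(\<Sum>\<sigma>\<in>S. sqrt (v * R)) < (\<Sum>\<sigma>\<in>S. p \<sigma>)"
    using S contra by (intro sum_strict_mono) (auto simp: p_def not_le)
  ultimately show False by simp
qed

lemma one_bit_obs_support:
  assumes "finite \<Omega>"
  shows "set_pmf (one_bit_obs f M \<Omega>) \<subseteq> PiE_dflt \<Omega> 0 (\<lambda>_. {1, -1})"
  using assms unfolding one_bit_obs_def by (subst set_Pi_pmf) (auto simp: PiE_dflt_def)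

text \<open>This makes the law a legitimate denominator for density ratios.\<close>

lemma one_bit_obs_full_support:
  assumes "finite \<Omega>" "\<And>ij. ij \<in> \<Omega> \<Longrightarrow> 0 < f (M $$ ij) \<and> f (M $$ ij) < 1"
  shows "PiE_dflt \<Omega> 0 (\<lambda>_. {1, -1}) \<subseteq> set_pmf (one_bit_obs f M \<Omega>)"
  using assms unfolding one_bit_obs_def
  by (subst set_Pi_pmf) (auto simp: PiE_dflt_def image_iff)

text \<open>The left side is 1 plus the chi-squared divergence. It is the expectation under the
  reference law of the squared density ratio, so independence turns it into a product of Bernoulli
  terms.\<close>

lemma sum_sq_ratio_one_bit_obs:
  assumes fin: "finite \<Omega>"
    and P: "\<And>ij. ij \<in> \<Omega> \<Longrightarrow> f (M $$ ij) \<in> {0..1}"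
    and Q: "\<And>ij. ij \<in> \<Omega> \<Longrightarrow> f (M\<^sub>0 $$ ij) \<in> {0<..<1}"
  shows "(\<Sum>y\<in>PiE_dflt \<Omega> 0 (\<lambda>_. {1, -1}).
            (pmf (one_bit_obs f M \<Omega>) y)\<^sup>2 / pmf (one_bit_obs f M\<^sub>0 \<Omega>) y)
         = (\<Prod>ij\<in>\<Omega>. 1 + (f (M $$ ij) - f (M\<^sub>0 $$ ij))\<^sup>2 / (f (M\<^sub>0 $$ ij) * (1 - f (M\<^sub>0 $$ ij))))"
proof -
  define sg where "sg = (\<lambda>b. if b then 1 else - 1 :: int)"
  define p where "p ij = map_pmf sg (bernoulli_pmf (f (M $$ ij)))" for ij
  define q where "q ij = map_pmf sg (bernoulli_pmf (f (M\<^sub>0 $$ ij)))" for ij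
  have inj: "inj sg" by (auto simp: inj_on_def sg_def)
  have obs: "one_bit_obs f M \<Omega> = Pi_pmf \<Omega> 0 p" "one_bit_obs f M\<^sub>0 \<Omega> = Pi_pmf \<Omega> 0 q"
    by (simp_all add: one_bit_obs_def p_def[abs_def] q_def[abs_def] sg_def)
  let ?Y = "PiE_dflt \<Omega> (0::int) (\<lambda>_. {1, -1})"
  define h where "h ij v = (pmf (p ij) v / pmf (q ij) v)\<^sup>2" for ij v
  have pm: "pmf (p ij) 1 = f (M $$ ij)" "pmf (p ij) (- 1) = 1 - f (M $$ ij)" if "ij \<in> \<Omega>" for ij
    using P[OF that] pmf_map_inj'[OF inj, of "bernoulli_pmf (f (M $$ ij))" True]
      pmf_map_inj'[OF inj, of "bernoulli_pmf (f (M $$ ij))" False]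
    by (auto simp: p_def sg_def)
  have qm: "pmf (q ij) 1 = f (M\<^sub>0 $$ ij)" "pmf (q ij) (- 1) = 1 - f (M\<^sub>0 $$ ij)"
    if "ij \<in> \<Omega>" for ij
    using Q[OF that] pmf_map_inj'[OF inj, of "bernoulli_pmf (f (M\<^sub>0 $$ ij))" True]
      pmf_map_inj'[OF inj, of "bernoulli_pmf (f (M\<^sub>0 $$ ij))" False]
    by (auto simp: q_def sg_def)
  have "(\<Sum>y\<in>?Y. (pmf (one_bit_obs f M \<Omega>) y)\<^sup>2 / pmf (one_bit_obs f M\<^sub>0 \<Omega>) y)
      = (\<Sum>y\<in>?Y. (\<Prod>ij\<in>\<Omega>. h ij (y ij)) * pmf (Pi_pmf \<Omega> 0 q) y)"
  proof (intro sum.cong refl)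
    fix y assume y: "y \<in> ?Y"
    have "pmf (q ij) (y ij) \<noteq> 0" if "ij \<in> \<Omega>" for ij
    proof -
      have "y ij = 1 \<or> y ij = - 1" using y that by (cases ij) (auto simp: PiE_dflt_def)
      then show ?thesis using qm[OF that] Q[OF that] by auto
    qed
    then have "(\<Prod>ij\<in>\<Omega>. pmf (q ij) (y ij)) \<noteq> 0"
      using fin by simp
    \<comment> \<open>The mass of a product law factors only at outcomes that take the default value
      0 off \<open>\<Omega>\<close>.\<close>
    moreover have "y ij = 0" if "ij \<notin> \<Omega>" for ij
      using y that by (cases ij) (auto simp: PiE_dflt_def)
    then have "pmf (Pi_pmf \<Omega> 0 p) y = (\<Prod>ij\<in>\<Omega>. pmf (p ij) (y ij))"
      "pmf (Pi_pmf \<Omega> 0 q) y = (\<Prod>ij\<in>\<Omega>. pmf (q ij) (y ij))"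
      by (auto intro: pmf_Pi'[OF fin])
    ultimately show "(pmf (one_bit_obs f M \<Omega>) y)\<^sup>2 / pmf (one_bit_obs f M\<^sub>0 \<Omega>) y
      = (\<Prod>ij\<in>\<Omega>. h ij (y ij)) * pmf (Pi_pmf \<Omega> 0 q) y"
      unfolding obs h_def by (simp add: prod_power_distrib prod_dividef power2_eq_square)
  qed
  also have "\<dots> = (\<integral>y. (\<Prod>ij\<in>\<Omega>. h ij (y ij)) \<partial>measure_pmf (Pi_pmf \<Omega> 0 q))"
    using one_bit_obs_support[OF fin, of f M\<^sub>0] fin
    by (intro integral_measure_pmf_real[symmetric]) (auto simp: obs)
  also have "\<dots> = (\<Prod>ij\<in>\<Omega>. \<integral>v. h ij v \<partial>measure_pmf (q ij))"
    using fin by (intro expectation_prod_Pi_pmf integrable_measure_pmf_finite) (auto simp: h_def q_def)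
  also have "\<dots> = (\<Prod>ij\<in>\<Omega>. 1 + (f (M $$ ij) - f (M\<^sub>0 $$ ij))\<^sup>2 / (f (M\<^sub>0 $$ ij) * (1 - f (M\<^sub>0 $$ ij))))"
  proof (intro prod.cong refl)
    fix ij assume ij: "ij \<in> \<Omega>"
    define u where "u = f (M $$ ij)"
    define w where "w = f (M\<^sub>0 $$ ij)"
    have w: "0 < w" "w < 1" using Q[OF ij] by (auto simp: w_def)
    have "(\<integral>v. h ij v \<partial>measure_pmf (q ij)) = (\<Sum>v\<in>{1, -1}. h ij v * pmf (q ij) v)"
      by (intro integral_measure_pmf_real) (auto simp: q_def sg_def)
    also have "\<dots> = (u / w)\<^sup>2 * w + ((1 - u) / (1 - w))\<^sup>2 * (1 - w)"
      using pm[OF ij] qm[OF ij] by (simp add: h_def u_def w_def)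
    also have "\<dots> = 1 + (u - w)\<^sup>2 / (w * (1 - w))"
      using w by (simp add: divide_simps power2_eq_square) (simp add: algebra_simps)
    finally show "(\<integral>v. h ij v \<partial>measure_pmf (q ij))
      = 1 + (f (M $$ ij) - f (M\<^sub>0 $$ ij))\<^sup>2 / (f (M\<^sub>0 $$ ij) * (1 - f (M\<^sub>0 $$ ij)))"
      by (simp add: u_def w_def)
  qed
  finally show ?thesis .
qed

text \<open>Each factor is bounded by \<open>1 + x \<le> exp x\<close>, with the Bernoulli variance
  at \<open>x0\<close> at least \<open>c' / 2\<close>.\<close>

lemma sum_sq_ratio_one_bit_obs_le:
  assumes fin: "finite \<Omega>" and f01: "\<And>x. f x \<in> {0..1}"
    and c': "0 < c'" "c' \<le> f x0" "f x0 \<le> 1 - c'"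
    and M\<^sub>0: "\<And>ij. ij \<in> \<Omega> \<Longrightarrow> M\<^sub>0 $$ ij = x0"
    and close: "\<And>ij. ij \<in> \<Omega> \<Longrightarrow> \<bar>f (M $$ ij) - f x0\<bar> \<le> \<delta>"
  shows "(\<Sum>y\<in>PiE_dflt \<Omega> 0 (\<lambda>_. {1, -1}).
            (pmf (one_bit_obs f M \<Omega>) y)\<^sup>2 / pmf (one_bit_obs f M\<^sub>0 \<Omega>) y)
         \<le> exp (real (card \<Omega>) * (2 * \<delta>\<^sup>2 / c'))"
proof -
  \<comment> \<open>The bounds on \<open>f x0\<close> force \<open>c' \<le> 1 / 2\<close>.\<close>
  have "c' * (1 / 2) \<le> c' * (1 - c')" using c' by (intro mult_left_mono) auto
  also have "c' * (1 - c') \<le> f x0 * (1 - f x0)"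
    using mult_nonneg_nonneg[of "f x0 - c'" "1 - c' - f x0"] c' by (simp add: algebra_simps)
  finally have var: "c' / 2 \<le> f x0 * (1 - f x0)" by simp
  have "1 + (f (M $$ ij) - f x0)\<^sup>2 / (f x0 * (1 - f x0)) \<le> exp (2 * \<delta>\<^sup>2 / c')" if "ij \<in> \<Omega>" for ij
  proof -
    have "(f (M $$ ij) - f x0)\<^sup>2 \<le> \<delta>\<^sup>2"
      using power_mono[OF close[OF that], of 2] by simp
    then have "(f (M $$ ij) - f x0)\<^sup>2 / (f x0 * (1 - f x0)) \<le> \<delta>\<^sup>2 / (c' / 2)"
      using var c' by (intro frac_le) auto
    also have "\<dots> = 2 * \<delta>\<^sup>2 / c'" by simp
    finally show ?thesis
      using exp_ge_add_one_self[of "2 * \<delta>\<^sup>2 / c'"] by linarith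
  qed
  moreover have "0 \<le> 1 + (f (M $$ ij) - f x0)\<^sup>2 / (f x0 * (1 - f x0))" for ij
    using var c' by (intro add_nonneg_nonneg divide_nonneg_nonneg) auto
  ultimately have "(\<Prod>ij\<in>\<Omega>. 1 + (f (M $$ ij) - f x0)\<^sup>2 / (f x0 * (1 - f x0))) \<le> (\<Prod>ij\<in>\<Omega>. exp (2 * \<delta>\<^sup>2 / c'))"
    by (intro prod_mono) auto
  moreover have "f (M\<^sub>0 $$ ij) \<in> {0<..<1}" if "ij \<in> \<Omega>" for ij
    using c' that M\<^sub>0 by auto
  ultimately show ?thesis
    using sum_sq_ratio_one_bit_obs[OF fin, of f M M\<^sub>0] f01 M\<^sub>0
    by (simp flip: exp_of_nat_mult cong: prod.cong)
qed

subsection \<open>Low-rank sign matrices\<close>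

text \<open>A class has at least \<open>m div B\<close> members, and rounding down costs at most a
  factor 2 since \<open>B \<le> m\<close>.\<close>

lemma card_residue_class_ge:
  assumes "b < B" "B \<le> m"
  shows "m \<le> 2 * B * card {i. i < m \<and> i mod B = b}"
proof -
  have "(\<lambda>k. b + B * k) ` {..<m div B} \<subseteq> {i. i < m \<and> i mod B = b}"
  proof safe
    fix k assume "k < m div B"
    then have "B * Suc k \<le> m"
      by (metis Suc_leI mult_le_mono2 order_trans times_div_less_eq_dividend)
    then show "b + B * k < m" using assms(1) by simp
  qed (use assms in simp)
  moreover have "inj_on (\<lambda>k. b + B * k) {..<m div B}"
    using assms(1) by (auto simp: inj_on_def)
  ultimately have "m div B \<le> card {i. i < m \<and> i mod B = b}"
    using card_inj_on_le[of _ "{..<m div B}" "{i. i < m \<and> i mod B = b}"] by fastforce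
  moreover have "m \<le> 2 * B * (m div B)"
  proof -
    have "1 \<le> m div B" using assms by (simp add: div_greater_zero_iff Suc_le_eq)
    then have "B \<le> B * (m div B)" by simp
    moreover have "m = B * (m div B) + m mod B" by simp
    moreover have "m mod B < B" using assms by simp
    ultimately show ?thesis by linarith
  qed
  ultimately show ?thesis
    by (meson mult_le_mono2 order_trans)
qed

text \<open>Bit vectors are encoded as sets, so that Hamming distance is the size of a symmetric
  difference. Keeping \<open>idx\<close> abstract covers both orientations of the matrix.\<close>

definition sign_matrix :: "nat \<Rightarrow> nat \<Rightarrow> real \<Rightarrow> (nat \<times> nat \<Rightarrow> 'a) \<Rightarrow> 'a set \<Rightarrow> real mat" where
  "sign_matrix d1 d2 s idx S = mat d1 d2 (\<lambda>ij. if idx ij \<in> S then s else - s)"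

lemma sign_matrix_carrier [simp]: "sign_matrix d1 d2 s idx S \<in> carrier_mat d1 d2"
  by (simp add: sign_matrix_def)

text \<open>Entry \<open>ij\<close> of the matrix carries bit \<open>idx ij\<close>.\<close>

lemma low_rank_pattern:
  assumes B: "0 < B" "B \<le> min d1 d2"
  shows "\<exists>idx :: nat \<times> nat \<Rightarrow> nat \<times> nat.
    (\<forall>b\<in>{..<B} \<times> {..<max d1 d2}.
        min d1 d2 \<le> 2 * B * card {ij \<in> {..<d1} \<times> {..<d2}. idx ij = b}) \<and>
    (\<forall>g :: nat \<times> nat \<Rightarrow> real. \<exists>U V. U \<in> carrier_mat d1 B \<and> V \<in> carrier_mat B d2 \<and>
        mat d1 d2 (\<lambda>ij. g (idx ij)) = U * V)"
proof (cases "d1 \<le> d2")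
  case True
  \<comment> \<open>Repetition runs along the shorter side, so the free bits fill \<open>B\<close>
    full rows of the longer length. Below, \<open>?U\<close> selects row \<open>i mod B\<close> of
    \<open>?V\<close>.\<close>
  let ?idx = "\<lambda>(i, j). (i mod B, j)"
  show ?thesis
  proof (intro exI[of _ ?idx] conjI ballI allI)
    fix b assume b: "b \<in> {..<B} \<times> {..<max d1 d2}"
    have eq: "{ij \<in> {..<d1} \<times> {..<d2}. ?idx ij = b} = {i. i < d1 \<and> i mod B = fst b} \<times> {snd b}"
      using b True by auto
    have "card {ij \<in> {..<d1} \<times> {..<d2}. ?idx ij = b} = card {i. i < d1 \<and> i mod B = fst b}"
      unfolding eq by (simp add: card_cartesian_product)
    then show "min d1 d2 \<le> 2 * B * card {ij \<in> {..<d1} \<times> {..<d2}. ?idx ij = b}"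
      using card_residue_class_ge[of "fst b" B d1] b B True
        by (simp only: mem_Times_iff lessThan_iff) simp
  next
    fix g :: "nat \<times> nat \<Rightarrow> real"
    let ?U = "mat d1 B (\<lambda>(i, b). if b = i mod B then 1 else 0 :: real)"
    let ?V = "mat B d2 g"
    have "mat d1 d2 (\<lambda>ij. g (?idx ij)) = ?U * ?V"
      using B by (intro eq_matI) (auto simp: scalar_prod_def if_distrib[of "\<lambda>x. x * _"] sum.delta cong: if_cong)
    then show "\<exists>U V. U \<in> carrier_mat d1 B \<and> V \<in> carrier_mat B d2 \<and> mat d1 d2 (\<lambda>ij. g (?idx ij)) = U * V"
      by (intro exI[of _ ?U] exI[of _ ?V]) auto
  qed
next
  case False
  let ?idx = "\<lambda>(i, j). (j mod B, i)"
  show ?thesis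
  proof (intro exI[of _ ?idx] conjI ballI allI)
    fix b assume b: "b \<in> {..<B} \<times> {..<max d1 d2}"
    have eq: "{ij \<in> {..<d1} \<times> {..<d2}. ?idx ij = b} = {snd b} \<times> {j. j < d2 \<and> j mod B = fst b}"
      using b False by auto
    have "card {ij \<in> {..<d1} \<times> {..<d2}. ?idx ij = b} = card {j. j < d2 \<and> j mod B = fst b}"
      unfolding eq by (simp add: card_cartesian_product)
    then show "min d1 d2 \<le> 2 * B * card {ij \<in> {..<d1} \<times> {..<d2}. ?idx ij = b}"
      using card_residue_class_ge[of "fst b" B d2] b B False
        by (simp only: mem_Times_iff lessThan_iff) simp
  next
    fix g :: "nat \<times> nat \<Rightarrow> real"
    let ?U = "mat d1 B (\<lambda>(i, b). g (b, i))"
    let ?V = "mat B d2 (\<lambda>(b, j). if b = j mod B then 1 else 0 :: real)"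
    have "mat d1 d2 (\<lambda>ij. g (?idx ij)) = ?U * ?V"
      using B by (intro eq_matI) (auto simp: scalar_prod_def if_distrib[of "\<lambda>x. _ * x"] sum.delta cong: if_cong)
    then show "\<exists>U V. U \<in> carrier_mat d1 B \<and> V \<in> carrier_mat B d2 \<and> mat d1 d2 (\<lambda>ij. g (?idx ij)) = U * V"
      by (intro exI[of _ ?U] exI[of _ ?V]) auto
  qed
qed

text \<open>The squared Frobenius norm is \<open>s^2 * d1 * d2\<close> and the rank is at most
  \<open>B\<close>, so the nuclear norm budget reduces to
  \<open>B * s^2 \<le> \<alpha>^2 * r\<close>.\<close>

lemma sign_matrix_in_matrix_class:
  assumes d: "0 < d1" "0 < d2" and s: "0 \<le> s" "s \<le> \<alpha>" and B: "B \<le> d2" "real B * s\<^sup>2 \<le> \<alpha>\<^sup>2 * r"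
    and UV: "U \<in> carrier_mat d1 B" "V \<in> carrier_mat B d2" "sign_matrix d1 d2 s idx S = U * V"
  shows "sign_matrix d1 d2 s idx S \<in> matrix_class d1 d2 \<alpha> r"
proof -
  let ?M = "sign_matrix d1 d2 s idx S"
  \<comment> \<open>Positive dimensions make the set under \<open>Max\<close> nonempty.\<close>
  have "?M $$ (0,0) \<in> elements_mat ?M"
    by (rule elements_matI[OF sign_matrix_carrier d refl])
  moreover have "elements_mat ?M \<subseteq> {s, - s}"
    by (auto simp: elements_mat_def sign_matrix_def)
  ultimately have "elements_mat ?M \<noteq> {}" "finite (elements_mat ?M)" "\<forall>x\<in>elements_mat ?M. \<bar>x\<bar> \<le> \<alpha>"
    using s finite_subset[of _ "{s, - s}"] by fastforce+
  then have "max_norm ?M \<le> \<alpha>"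
    unfolding max_norm_def by (subst Max_le_iff) auto
  moreover have "nuclear_norm ?M \<le> \<alpha> * sqrt (r * real d1 * real d2)"
  proof -
    have "nuclear_norm ?M \<le> sqrt (real B * (\<Sum>i<d1. \<Sum>j<d2. (?M $$ (i,j))\<^sup>2))"
      unfolding UV(3) using UV(1,2) B(1) by (rule nuclear_norm_mult_le)
    also have "(\<Sum>i<d1. \<Sum>j<d2. (?M $$ (i,j))\<^sup>2) = (\<Sum>i<d1. \<Sum>j<d2. s\<^sup>2)"
      by (intro sum.cong) (auto simp: sign_matrix_def)
    also have "real B * \<dots> = (real B * s\<^sup>2) * (real d1 * real d2)"
      by simp
    also have "sqrt \<dots> \<le> sqrt ((\<alpha>\<^sup>2 * r) * (real d1 * real d2))"
      using B(2) by (intro real_sqrt_le_mono mult_right_mono) auto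
    also have "\<dots> = \<alpha> * sqrt (r * real d1 * real d2)"
      using s by (simp add: real_sqrt_mult mult_ac)
    finally show ?thesis .
  qed
  ultimately show ?thesis by (simp add: matrix_class_def)
qed

text \<open>Each differing bit is repeated in at least \<open>min d1 d2 / (2 * B)\<close> entries,
  and each of these contributes at least \<open>\<kappa>\<close>.\<close>

lemma hamming_le_hellinger_sq_mat:
  assumes d: "0 < d1" "0 < d2" and fin: "finite I" and ST: "S \<subseteq> I" "T \<subseteq> I"
    and idx: "\<And>b. b \<in> I \<Longrightarrow> min d1 d2 \<le> 2 * B * card {ij \<in> {..<d1} \<times> {..<d2}. idx ij = b}"
    and \<kappa>: "0 \<le> \<kappa>" "\<kappa> \<le> hellinger_sq (f s) (f (- s))" "\<kappa> \<le> hellinger_sq (f (- s)) (f s)"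
  shows "\<kappa> * real (card (sym_diff S T)) \<le> 2 * real B * real (max d1 d2) *
    hellinger_sq_mat (map_mat f (sign_matrix d1 d2 s idx S)) (map_mat f (sign_matrix d1 d2 s idx T))"
proof -
  let ?J = "{..<d1} \<times> {..<d2}"
  define \<Delta> where "\<Delta> = sym_diff S T"
  define H where "H = (\<Sum>i<d1. \<Sum>j<d2. hellinger_sq (f (sign_matrix d1 d2 s idx S $$ (i,j)))
    (f (sign_matrix d1 d2 s idx T $$ (i,j))))"
  have fin\<Delta>: "finite \<Delta>" using ST fin by (auto simp: \<Delta>_def intro: finite_subset)
  have "real (min d1 d2) * real (card \<Delta>) = (\<Sum>b\<in>\<Delta>. real (min d1 d2))" by simp
  also have "\<dots> \<le> (\<Sum>b\<in>\<Delta>. real (2 * B * card {ij \<in> ?J. idx ij = b}))"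
    using idx ST by (intro sum_mono of_nat_mono) (auto simp: \<Delta>_def)
  also have "\<dots> = 2 * real B * (\<Sum>b\<in>\<Delta>. \<Sum>ij | ij \<in> {ij \<in> ?J. idx ij \<in> \<Delta>} \<and> idx ij = b. 1)"
    by (auto simp: sum_distrib_left intro!: sum.cong arg_cong[of _ _ card])
  also have "\<dots> = 2 * real B * (\<Sum>ij\<in>{ij \<in> ?J. idx ij \<in> \<Delta>}. 1)"
    using fin\<Delta> by (subst sum.group) auto
  finally have 1: "real (min d1 d2) * real (card \<Delta>) \<le> 2 * real B * real (card {ij \<in> ?J. idx ij \<in> \<Delta>})"
    by simp
  have "\<kappa> * real (card {ij \<in> ?J. idx ij \<in> \<Delta>}) = (\<Sum>ij\<in>?J. if idx ij \<in> \<Delta> then \<kappa> else 0)"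
    by (simp add: sum.If_cases Int_def)
  also have "\<dots> \<le> (\<Sum>ij\<in>?J. hellinger_sq (f (sign_matrix d1 d2 s idx S $$ ij)) (f (sign_matrix d1 d2 s idx T $$ ij)))"
    using \<kappa> by (intro sum_mono) (auto simp: sign_matrix_def \<Delta>_def hellinger_sq_nonneg)
  also have "\<dots> = H"
    by (simp add: H_def sum.cartesian_product case_prod_unfold)
  finally have 2: "\<kappa> * real (card {ij \<in> ?J. idx ij \<in> \<Delta>}) \<le> H" .
  have "real (min d1 d2) * (\<kappa> * real (card \<Delta>)) \<le> \<kappa> * (2 * real B * real (card {ij \<in> ?J. idx ij \<in> \<Delta>}))"
    using mult_left_mono[OF 1 \<kappa>(1)] by (simp add: mult_ac)
  also have "\<dots> \<le> 2 * real B * H"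
    using mult_left_mono[OF 2, of "2 * real B"] by (simp add: mult_ac)
  finally have "\<kappa> * real (card \<Delta>) \<le> 2 * real B * H / real (min d1 d2)"
    using d by (simp add: pos_le_divide_eq mult_ac)
  also have "\<dots> = 2 * real B * (H / real (min d1 d2))"
    by simp
  \<comment> \<open>The product \<open>d1 * d2\<close> equals
    \<open>min d1 d2 * max d1 d2\<close>.\<close>
  also have "H / real (min d1 d2) = real (max d1 d2) * (H / (real d1 * real d2))"
    using d by (auto simp: min_def max_def)
  also have "2 * real B * \<dots> = 2 * real B * real (max d1 d2) * (H / (real d1 * real d2))"
    by simp
  also have "H / (real d1 * real d2) = hellinger_sq_mat (map_mat f (sign_matrix d1 d2 s idx S)) (map_mat f (sign_matrix d1 d2 s idx T))"
    by (simp add: hellinger_sq_mat_def H_def sign_matrix_def)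
  finally show ?thesis by (simp add: \<Delta>_def)
qed

subsection \<open>The minimax bound\<close>

text \<open>The Bernoulli variance \<open>f x * (1 - f x)\<close> is at most
  \<open>1 / 4\<close>.\<close>

lemma link_deriv_le:
  assumes bdd: "bdd_above ((\<lambda>x. \<bar>deriv f x\<bar> / (f x * (1 - f x))) ` {-1..1})"
    and x: "x \<in> {-1..1}" "f x \<in> {0<..<1}"
  shows "\<bar>deriv f x\<bar> \<le> L1_const f / 4"
proof -
  have pos: "0 < f x * (1 - f x)" using x by simp
  have "\<bar>deriv f x\<bar> / (f x * (1 - f x)) \<le> L1_const f"
    unfolding L1_const_def by (rule cSUP_upper[OF x(1) bdd])
  then have *: "\<bar>deriv f x\<bar> \<le> L1_const f * (f x * (1 - f x))"
    using pos by (simp add: pos_divide_le_eq)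
  then have "0 \<le> L1_const f * (f x * (1 - f x))" by linarith
  then have "0 \<le> L1_const f" using pos by (simp add: zero_le_mult_iff)
  moreover have "f x * (1 - f x) \<le> 1 / 4"
    using zero_le_power2[of "f x - 1 / 2"] by (simp add: power2_eq_square algebra_simps)
  ultimately have "L1_const f * (f x * (1 - f x)) \<le> L1_const f * (1 / 4)"
    by (rule mult_left_mono[rotated])
  with * show ?thesis by simp
qed

text \<open>Keeps the data laws close to the law of the zero matrix.\<close>

lemma link_lipschitz:
  assumes diff: "\<And>x. f differentiable (at x)"
    and bound: "\<And>x. x \<in> {-1..1} \<Longrightarrow> \<bar>deriv f x\<bar> \<le> K"
    and x: "x \<in> {-1..1::real}"
  shows "\<bar>f x - f 0\<bar> \<le> K * \<bar>x\<bar>"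
proof -
  have "norm (f x - f 0) \<le> K * norm (x - 0)"
  proof (rule field_differentiable_bound[of "{-1..1}" f "deriv f" K])
    fix z assume "z \<in> {-1..1 :: real}"
    show "(f has_field_derivative deriv f z) (at z within {-1..1})"
      using diff[of z] by (simp add: DERIV_deriv_iff_real_differentiable has_field_derivative_at_within)
  qed (use x bound in auto)
  then show ?thesis by simp
qed

text \<open>Separates the hypotheses in Hellinger distance. The mean value theorem needs a
  nondegenerate interval, hence the case split.\<close>

lemma link_gap:
  assumes diff: "\<And>x. f differentiable (at x)"
    and bound: "\<And>x. x \<in> {-1..1} \<Longrightarrow> c \<le> deriv f x"
    and s: "0 \<le> s" "s \<le> (1::real)"
  shows "2 * c * s \<le> f s - f (- s)"
proof (cases "s = 0")
  case False
  then have "- s < s" using s by simp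
  then obtain z where z: "- s < z" "z < s" "f s - f (- s) = (s - (- s)) * deriv f z"
    using MVT2[of "- s" s f "deriv f"] diff by (auto simp: DERIV_deriv_iff_real_differentiable)
  have "2 * s * c \<le> 2 * s * deriv f z"
    using z s by (intro mult_left_mono bound) auto
  with z show ?thesis by (simp add: mult_ac)
qed simp

text \<open>Any \<open>\<epsilon>\<close> below both terms of the minimum is allowed. In
  \<open>K\<close>, the first summand yields \<open>c^2 * K \<ge> 32\<close>, which fixes the
  Hamming radius, and the second yields \<open>K \<ge> 1\<close>.\<close>

lemma one_bit_minimax_lower_bound:
  fixes f :: "real \<Rightarrow> real" and A :: "(nat \<times> nat \<Rightarrow> int) \<Rightarrow> real mat measure"
  assumes c: "0 < c" "0 < c'"
    and K: "K = 32 / c\<^sup>2 + 1"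
    and d: "0 < d1" "0 < d2" and \<alpha>: "1 \<le> \<alpha>" and r: "4 \<le> r"
    and big: "128 \<le> \<alpha>\<^sup>2 * r * real (max d1 d2)"
    and f01: "\<And>x. f x \<in> {0..1}" and diff: "\<And>x. f differentiable (at x)"
    and bdd: "bdd_above ((\<lambda>x. \<bar>deriv f x\<bar> / (f x * (1 - f x))) ` {-1..1})"
    and f: "\<And>x. x \<in> {-1..1} \<Longrightarrow> c \<le> deriv f x \<and> c' \<le> f x \<and> f x \<le> 1 - c'"
    and \<Omega>: "\<Omega> \<subseteq> {..<d1} \<times> {..<d2}"
    and A: "mat_algorithm d1 d2 A"
    and \<epsilon>: "\<epsilon> \<le> 1 / K" "\<epsilon> \<le> sqrt c' / (2 * K) * (\<alpha> / L1_const f) * sqrt (r * real (max d1 d2) / real (card \<Omega>))"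
    and \<epsilon>_gt: "r * \<alpha>\<^sup>2 / real (min d1 d2) < \<epsilon>"
  shows "\<exists>M \<in> matrix_class d1 d2 \<alpha> r.
     3 / 4 \<le> measure (estimate_law f M \<Omega> A)
        {Mhat \<in> carrier_mat d1 d2. \<epsilon> \<le> hellinger_sq_mat (map_mat f M) (map_mat f Mhat)}"
proof -
  define L where "L = L1_const f"
  define D where "D = max d1 d2"
  define n where "n = card \<Omega>"
  have fin: "finite \<Omega>" using \<Omega> by (rule finite_subset) simp
  have K1: "1 \<le> K" by (simp add: K)
  have cK: "32 \<le> c\<^sup>2 * K" using c by (simp add: K field_simps)
  have "0 < r * \<alpha>\<^sup>2 / real (min d1 d2)" using r \<alpha> d by simp
  then have \<epsilon>0: "0 < \<epsilon>" using \<epsilon>_gt by linarith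
  \<comment> \<open>The bound \<open>\<epsilon> \<le> 1 / K\<close> gives \<open>s \<le> 1\<close>,
    so \<open>s\<close> and \<open>-s\<close> stay where \<open>f\<close> is controlled.\<close>
  define s where "s = sqrt (K * \<epsilon>)"
  have s2: "s\<^sup>2 = K * \<epsilon>" using \<epsilon>0 K1 by (simp add: s_def)
  have s: "0 < s" "s \<le> 1" using \<epsilon>0 K1 \<epsilon>(1) by (auto simp: s_def field_simps)
  have s2': "0 < s\<^sup>2" "s\<^sup>2 \<le> 1" using s by (auto simp: power_le_one)
  have deriv_le: "\<bar>deriv f x\<bar> \<le> L / 4" if "x \<in> {-1..1}" for x
    unfolding L_def using bdd that by (rule link_deriv_le) (use f[OF that] c in auto)
  have L: "0 < L" using deriv_le[of 0] f[of 0] c by auto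

  \<comment> \<open>The largest real period that respects the nuclear norm budget. As
    \<open>q \<ge> 4\<close>, rounding down to \<open>B\<close> loses at most a factor 2.\<close>
  define q where "q = \<alpha>\<^sup>2 * r / s\<^sup>2"
  define B where "B = nat \<lfloor>q\<rfloor>"
  have \<alpha>2: "1 \<le> \<alpha>\<^sup>2" using \<alpha> by simp
  have "4 \<le> \<alpha>\<^sup>2 * r" using mult_mono[OF \<alpha>2 r] by simp
  moreover have q_ge: "\<alpha>\<^sup>2 * r \<le> q"
    using s2' r \<alpha> by (simp add: q_def pos_le_divide_eq mult_left_le)
  ultimately have q4: "4 \<le> q" by linarith
  have B_q: "real B \<le> q" "q < real B + 1" using q4 by (auto simp: B_def)
  have B0: "0 < B" using B_q q4 by linarith
  have q_B: "q \<le> 2 * real B" using B_q q4 by linarith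
  have Bs: "real B * s\<^sup>2 \<le> \<alpha>\<^sup>2 * r"
    using B_q(1) s2' by (simp add: q_def pos_le_divide_eq)
  \<comment> \<open>The requirement that \<open>\<epsilon>\<close> exceed
    \<open>r * \<alpha>^2 / min d1 d2\<close> enters here: with \<open>\<epsilon> \<le> s^2\<close>
    it makes the period fit into the shorter side.\<close>
  have "r * \<alpha>\<^sup>2 < \<epsilon> * real (min d1 d2)" using \<epsilon>_gt d by (simp add: pos_divide_less_eq)
  also have "\<dots> \<le> s\<^sup>2 * real (min d1 d2)" using K1 \<epsilon>0 by (intro mult_right_mono) (auto simp: s2)
  finally have "q < real (min d1 d2)" using s2' by (simp add: q_def pos_divide_less_eq mult_ac)
  then have B_min: "B \<le> min d1 d2" using B_q(1) by linarith

  define I where "I = {..<B} \<times> {..<D}"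
  define N where "N = card I"
  have I: "finite I" by (simp add: I_def)
  have N: "real N = real B * real D" by (simp add: N_def I_def)
  have qD: "q * real D \<le> 2 * real N" using mult_right_mono[OF q_B, of "real D"] by (simp add: N)
  have "\<alpha>\<^sup>2 * r * real D \<le> q * real D" using q_ge by (intro mult_right_mono) auto
  then have N64: "64 \<le> real N" using big qD by (simp add: D_def)

  \<comment> \<open>The left side will bound the logarithm of 1 plus the chi-squared divergence. The
    second bound on \<open>\<epsilon>\<close> is squared, and one factor \<open>s^2\<close> cancels
    after \<open>\<alpha>^2 * r\<close> is written as \<open>s^2 * q\<close>.\<close>
  have budget: "real n * (2 * (L / 4 * s)\<^sup>2 / c') \<le> real N / 16"
  proof -
    \<comment> \<open>For \<open>n = 0\<close>, division by zero yields 0, so the second bound would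
      force \<open>\<epsilon> \<le> 0\<close>.\<close>
    have n0: "0 < real n"
    proof (rule ccontr)
      assume "\<not> 0 < real n"
      then have "\<epsilon> \<le> 0" using \<epsilon>(2) by (simp add: n_def)
      with \<epsilon>0 show False by simp
    qed
    have "\<epsilon> * L \<le> sqrt c' / (2 * K) * (\<alpha> / L) * sqrt (r * real D / real n) * L"
      using \<epsilon>(2) L by (intro mult_right_mono) (auto simp: L_def D_def n_def)
    also have "\<dots> = sqrt c' / (2 * K) * \<alpha> * sqrt (r * real D / real n)"
      using L by simp
    finally have "(\<epsilon> * L)\<^sup>2 \<le> (sqrt c' / (2 * K) * \<alpha> * sqrt (r * real D / real n))\<^sup>2"
      using \<epsilon>0 L by (intro power_mono) auto
    also have "\<dots> = c' / (4 * K\<^sup>2) * \<alpha>\<^sup>2 * (r * real D / real n)"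
      using c r by (simp add: power_mult_distrib power_divide)
    finally have "4 * K\<^sup>2 * real n * (\<epsilon> * L)\<^sup>2
        \<le> 4 * K\<^sup>2 * real n * (c' / (4 * K\<^sup>2) * \<alpha>\<^sup>2 * (r * real D / real n))"
      by (intro mult_left_mono) auto
    also have "\<dots> = c' * (\<alpha>\<^sup>2 * r) * real D"
      using K1 n0 by simp
    also have "\<alpha>\<^sup>2 * r = s\<^sup>2 * q"
      using s2' by (simp add: q_def)
    also have "4 * K\<^sup>2 * real n * (\<epsilon> * L)\<^sup>2 = 4 * (K * \<epsilon>)\<^sup>2 * (L\<^sup>2 * real n)"
      by (simp add: power_mult_distrib)
    also have "\<dots> = s\<^sup>2 * (4 * (s\<^sup>2 * L\<^sup>2 * real n))"
      unfolding s2[symmetric] power2_eq_square[of "s\<^sup>2"] by simp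
    also have "c' * (s\<^sup>2 * q) * real D = s\<^sup>2 * (c' * (q * real D))"
      by simp
    also have "\<dots> \<le> s\<^sup>2 * (c' * (2 * real N))"
      using qD c by (intro mult_left_mono) auto
    finally have "4 * (s\<^sup>2 * L\<^sup>2 * real n) \<le> c' * (2 * real N)"
      using s2' by (simp only: mult_le_cancel_left_pos)
    then have "s\<^sup>2 * L\<^sup>2 * real n / (8 * c') \<le> real N / 16"
      using c by (simp add: pos_divide_le_eq mult.commute[of c'])
    also have "s\<^sup>2 * L\<^sup>2 * real n / (8 * c') = real n * (2 * (L / 4 * s)\<^sup>2 / c')"
      by (simp add: power_mult_distrib power_divide)
    finally show ?thesis .
  qed

  obtain idx :: "nat \<times> nat \<Rightarrow> nat \<times> nat" where
    idx: "\<And>b. b \<in> I \<Longrightarrow> min d1 d2 \<le> 2 * B * card {ij \<in> {..<d1} \<times> {..<d2}. idx ij = b}"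
    and low_rank: "\<And>g :: nat \<times> nat \<Rightarrow> real. \<exists>U V. U \<in> carrier_mat d1 B \<and> V \<in> carrier_mat B d2 \<and>
        mat d1 d2 (\<lambda>ij. g (idx ij)) = U * V"
    using low_rank_pattern[OF B0 B_min, folded D_def, folded I_def] by blast
  define M where "M S = sign_matrix d1 d2 s idx S" for S
  have cM: "M S \<in> carrier_mat d1 d2" for S by (simp add: M_def)
  have M_class: "M S \<in> matrix_class d1 d2 \<alpha> r" for S
  proof -
    obtain U V where "U \<in> carrier_mat d1 B" "V \<in> carrier_mat B d2" "M S = U * V"
      using low_rank[of "\<lambda>b. if b \<in> S then s else - s"] by (auto simp: M_def sign_matrix_def)
    then show ?thesis
      unfolding M_def using d s \<alpha> B_min Bs by (intro sign_matrix_in_matrix_class) auto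
  qed

  \<comment> \<open>\<open>E S\<close> contains the estimates that succeed for \<open>S\<close>; its
    complement \<open>F S\<close> is the event of the claim.\<close>
  define E where "E S = {Mhat \<in> carrier_mat d1 d2. hellinger_sq_mat (map_mat f (M S)) (map_mat f Mhat) < \<epsilon>}"
    for S
  define F where "F S = {Mhat \<in> carrier_mat d1 d2. \<epsilon> \<le> hellinger_sq_mat (map_mat f (M S)) (map_mat f Mhat)}"
    for S
  have F_sets: "F S \<in> sets (mat_borel d1 d2)" for S
    unfolding F_def by (rule measurable_hellinger_sq_mat[OF diff cM])
  have E_F: "E S = space (mat_borel d1 d2) - F S" for S
    by (auto simp: E_def F_def)
  have E_sets: "E S \<in> sets (mat_borel d1 d2)" for S
    unfolding E_F using F_sets by (intro sets.compl_sets)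

  have gap: "2 * c\<^sup>2 * s\<^sup>2 \<le> (f s - f (- s))\<^sup>2 / 2"
    using power_mono[OF link_gap[OF diff, of c s], of 2] f s c
    by (simp add: power_mult_distrib)
  \<comment> \<open>The quasi-triangle inequality through \<open>X\<close> gives distance at most
    \<open>4 * \<epsilon>\<close>. With \<open>s^2 = K * \<epsilon>\<close> the factor
    \<open>\<epsilon>\<close> cancels, leaving
    \<open>32 * card (sym_diff S T) \<le> 4 * N\<close>.\<close>
  have ball: "8 * card (sym_diff S T) \<le> card I"
    if ST: "S \<subseteq> I" "T \<subseteq> I" and X: "X \<in> E S" "X \<in> E T" for S T X
  proof -
    have "2 * c\<^sup>2 * s\<^sup>2 * real (card (sym_diff S T))
        \<le> 2 * real B * real D * hellinger_sq_mat (map_mat f (M S)) (map_mat f (M T))"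
      unfolding M_def D_def using d I ST idx c gap f01 hellinger_sq_ge[of "f s" "f (- s)"] hellinger_sq_ge[of "f (- s)" "f s"]
      by (intro hamming_le_hellinger_sq_mat[where I=I]) (auto simp: power2_commute[of "f (- s)"] intro: order_trans)
    also have "\<dots> \<le> 2 * real B * real D * (4 * \<epsilon>)"
    proof (rule mult_left_mono)
      have "hellinger_sq_mat (map_mat f (M S)) (map_mat f (M T))
        \<le> 2 * hellinger_sq_mat (map_mat f (M S)) (map_mat f X) + 2 * hellinger_sq_mat (map_mat f (M T)) (map_mat f X)"
        using cM X by (intro hellinger_sq_mat_quasi_triangle[where ?d1.0 = d1 and ?d2.0 = d2]) (auto simp: E_def)
      then show "hellinger_sq_mat (map_mat f (M S)) (map_mat f (M T)) \<le> 4 * \<epsilon>"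
        using X unfolding E_def by auto
    qed simp
    finally have "2 * \<epsilon> * (c\<^sup>2 * K * real (card (sym_diff S T))) \<le> 2 * \<epsilon> * (4 * real N)"
      unfolding s2 N by (simp only: mult_ac)
    then have "c\<^sup>2 * K * real (card (sym_diff S T)) \<le> 4 * real N"
      by (rule mult_left_le_imp_le) (use \<epsilon>0 in simp)
    moreover have "32 * real (card (sym_diff S T)) \<le> c\<^sup>2 * K * real (card (sym_diff S T))"
      using cK by (intro mult_right_mono) auto
    ultimately have "8 * real (card (sym_diff S T)) \<le> real N" by linarith
    then show ?thesis by (simp add: N_def)
  qed

  let ?Y = "PiE_dflt \<Omega> (0 :: int) (\<lambda>_. {1, -1})"
  have M0: "0\<^sub>m d1 d2 $$ ij = (0 :: real)" if "ij \<in> \<Omega>" for ij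
    using that \<Omega> by auto
  \<comment> \<open>Here \<open>v = exp (- N / 8)\<close> is the relative volume of a Hamming ball
    and \<open>R = exp (N / 16)\<close> the cost of changing the measure.\<close>
  have "\<exists>S\<in>Pow I. measure (Giry_Monad.bind (measure_pmf (one_bit_obs f (M S) \<Omega>)) A) (E S)
      \<le> sqrt (exp (- real N / 8) * exp (real N / 16))"
  proof (rule exists_hypothesis_small_success[where Y = ?Y and Q = "one_bit_obs f (0\<^sub>m d1 d2) \<Omega>" and N = "mat_borel d1 d2"])
    fix X assume "X \<in> space (mat_borel d1 d2)"
    show "real (card {S \<in> Pow I. X \<in> E S}) \<le> exp (- real N / 8) * real (card (Pow I))"
    proof (cases "\<exists>T\<in>Pow I. X \<in> E T")
      case True
      then obtain T where T: "T \<subseteq> I" "X \<in> E T" by auto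
      \<comment> \<open>The ball is centred at one hypothesis \<open>T\<close> for which
        \<open>X\<close> succeeds.\<close>
      have "card {S \<in> Pow I. X \<in> E S} \<le> card {S \<in> Pow I. 8 * card (sym_diff S T) \<le> card I}"
        using I T ball by (intro card_mono) auto
      also have "real \<dots> \<le> exp (- real N / 8) * 2 ^ card I"
        unfolding N_def by (rule card_hamming_ball_le[OF I T(1)])
      finally show ?thesis using I by (simp add: card_Pow)
    next
      case False
      then have "{S \<in> Pow I. X \<in> E S} = {}" by auto
      then show ?thesis by (simp only: card.empty) simp
    qed
  next
    fix S
    have "\<bar>f (M S $$ ij) - f 0\<bar> \<le> L / 4 * s" if "ij \<in> \<Omega>" for ij
    proof -
      have abs: "\<bar>M S $$ ij\<bar> = s" using that \<Omega> s by (auto simp: M_def sign_matrix_def)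
      then have "M S $$ ij \<in> {-1..1}" using s by (auto simp: abs_if split: if_splits)
      from link_lipschitz[OF diff deriv_le this] show ?thesis by (simp only: abs)
    qed
    then have "(\<Sum>y\<in>?Y. (pmf (one_bit_obs f (M S) \<Omega>) y)\<^sup>2 / pmf (one_bit_obs f (0\<^sub>m d1 d2) \<Omega>) y)
        \<le> exp (real n * (2 * (L / 4 * s)\<^sup>2 / c'))"
      unfolding n_def using fin f01 c f[of 0] M0
        by (intro sum_sq_ratio_one_bit_obs_le[where ?x0.0 = 0]) auto
    also have "\<dots> \<le> exp (real N / 16)" using budget by simp
    finally show "(\<Sum>y\<in>?Y. (pmf (one_bit_obs f (M S) \<Omega>) y)\<^sup>2 / pmf (one_bit_obs f (0\<^sub>m d1 d2) \<Omega>) y)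
        \<le> exp (real N / 16)" .
  next
    show "?Y \<subseteq> set_pmf (one_bit_obs f (0\<^sub>m d1 d2) \<Omega>)"
      using fin M0 f[of 0] c by (intro one_bit_obs_full_support) auto
  next
    fix S show "set_pmf (one_bit_obs f (M S) \<Omega>) \<subseteq> ?Y"
      by (rule one_bit_obs_support[OF fin])
  qed (use I fin A E_sets in \<open>auto simp: mat_algorithm_def\<close>)
  then obtain S where S: "measure (estimate_law f (M S) \<Omega> A) (E S) \<le> sqrt (exp (- real N / 8) * exp (real N / 16))"
    unfolding estimate_law_def by auto
  \<comment> \<open>\<open>N \<ge> 64\<close> brings the product down to \<open>exp (- 4)\<close>,
    and \<open>exp 1 \<ge> 2\<close> does the rest.\<close>
  have "exp (- real N / 8) * exp (real N / 16) \<le> (1 / 4)\<^sup>2"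
  proof -
    have "exp (- real N / 8) * exp (real N / 16) = exp (- real N / 16)"
      by (simp flip: exp_add)
    also have "\<dots> \<le> exp (- 1) ^ 4"
      using N64 by (simp flip: exp_of_nat_mult)
    also have "\<dots> \<le> (1 / 2) ^ 4"
      using exp_ge_add_one_self[of 1] by (intro power_mono) (auto simp: exp_minus field_simps)
    finally show ?thesis by (simp add: power_divide)
  qed
  then have "sqrt (exp (- real N / 8) * exp (real N / 16)) \<le> 1 / 4"
    by (intro real_le_lsqrt) auto
  with S have E_le: "measure (estimate_law f (M S) \<Omega> A) (E S) \<le> 1 / 4" by linarith
  have pmf_in: "measure_pmf (one_bit_obs f (M S) \<Omega>) \<in> space (prob_algebra (count_space UNIV))"
    by (simp add: space_prob_algebra measure_pmf.prob_space_axioms)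
  have A': "A \<in> count_space UNIV \<rightarrow>\<^sub>M prob_algebra (mat_borel d1 d2)"
    using A by (simp add: mat_algorithm_def)
  have sets_law: "sets (estimate_law f (M S) \<Omega> A) = sets (mat_borel d1 d2)"
    unfolding estimate_law_def by (rule sets_bind'[OF pmf_in A'])
  interpret law: prob_space "estimate_law f (M S) \<Omega> A"
    unfolding estimate_law_def by (rule prob_space_bind'[OF pmf_in A'])
  have "law.prob (E S) = 1 - law.prob (F S)"
    unfolding E_F sets_eq_imp_space_eq[OF sets_law, symmetric]
    using F_sets sets_law by (intro law.prob_compl) auto
  with E_le have "3 / 4 \<le> law.prob (F S)" by linarith
  then show ?thesis
    using M_class unfolding F_def by blast
qed

theorem theorem5:
  shows "\<exists>C\<^sub>0>0::real. \<forall>c>0. \<forall>c'>0. \<exists>C\<^sub>1>0. \<exists>C\<^sub>2>0.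
    \<forall>(d1::nat) (d2::nat) (\<alpha>::real) (r::real) (f :: real \<Rightarrow> real) (\<Omega> :: (nat \<times> nat) set) (n::nat)
      (A :: (nat \<times> nat \<Rightarrow> int) \<Rightarrow> real mat measure).
      0 < d1 \<and> 0 < d2 \<and> 1 \<le> \<alpha> \<and> 4 \<le> r \<and> C\<^sub>0 \<le> \<alpha>^2 * r * real (max d1 d2) \<and>
      (\<forall>x. f x \<in> {0..1}) \<and> (\<forall>x. f differentiable (at x)) \<and>
      bdd_above ((\<lambda>x. \<bar>deriv f x\<bar> / (f x * (1 - f x))) ` {-1..1}) \<and>
      (\<forall>x\<in>{-1..1}. c \<le> deriv f x \<and> c' \<le> f x \<and> f x \<le> 1 - c') \<and>
      \<Omega> \<subseteq> {..<d1} \<times> {..<d2} \<and> card \<Omega> = n \<and>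
      mat_algorithm d1 d2 A \<longrightarrow>
      (let \<epsilon> = min C\<^sub>1 (C\<^sub>2 * (\<alpha> / L1_const f) * sqrt (r * real (max d1 d2) / real n))
       in r * \<alpha>^2 / real (min d1 d2) < \<epsilon> \<longrightarrow>
          (\<exists>M \<in> matrix_class d1 d2 \<alpha> r.
             3 / 4 \<le> measure (estimate_law f M \<Omega> A)
               {Mhat \<in> carrier_mat d1 d2.
                  \<epsilon> \<le> hellinger_sq_mat (map_mat f M) (map_mat f Mhat)}))"
proof (rule exI[of _ 128], rule conjI, simp, intro allI impI, goal_cases)
  case (1 c c')
  \<comment> \<open>Only \<open>K\<close> and \<open>sqrt c'\<close> enter the two remaining
    constants; the threshold 128 was fixed before \<open>c\<close> and \<open>c'\<close>.\<close>
  define K where "K = 32 / c\<^sup>2 + 1"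
  have K: "0 < 1 / K" "0 < sqrt c' / (2 * K)"
    using 1 by (simp_all add: K_def add_nonneg_pos)
  show ?case
  proof (rule exI[of _ "1 / K"], rule conjI[OF K(1)], rule exI[of _ "sqrt c' / (2 * K)"],
      rule conjI[OF K(2)], unfold Let_def, intro allI impI, elim conjE, goal_cases)
    case H: (1 d1 d2 \<alpha> r f \<Omega> n A)
    show ?case
      \<comment> \<open>\<open>H(1)\<close> is the lower bound on \<open>\<epsilon>\<close>, as
        \<open>elim conjE\<close> appends the conjuncts after it. The two gaps are the bounds of the
        minimum by its terms.\<close>
      by (rule one_bit_minimax_lower_bound[OF 1 K_def H(2-6) H(7)[rule_format] H(8)[rule_format]
            H(9) H(10)[rule_format] H(11,13) _ _ H(1)])
        (simp_all only: H(12) min.cobounded1 min.cobounded2)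
  qed
qed

end
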